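(* Let the transmitted constellation symbols $x[0],\dots,x[N_{\rm sc}-1]$ be i.i.d. complex random variables with zero mean and unit energy $\mathbb{E}[|x[m]|^2]=1$. Then, for every $m\in\{0,\dots,N_{\rm sc}-1\}$, the effective SINR of the received symbol $r[m]=\mu_G x[m]+\mathsf{ICI}[m]+n[m]$, namely $\mathsf{SINR}^{\rm iid\mathbb{C}}=\mu_G^2/\left(\mathbb{E}[|\mathsf{ICI}[m]|^2]+\mathbb{E}[|n[m]|^2]\right)$, equals $$\mathsf{SINR}^{\rm iid\mathbb{C}}=\frac{\mu_G^2}{\sigma_G^2+\mu_{|E|^2}},$$ where the noise power is $$\mathbb{E}[|n[m]|^2]=\mu_{|E|^2}=\frac{1}{N_{\rm sc}}\sum_{k=0}^{N_{\rm sc}-1}|E_k|^2$$ and the interference power is $$\mathbb{E}[|\mathsf{ICI}[m]|^2]=\sigma_G^2=\frac{1}{N_{\rm sc}}\sum_{k=0}^{N_{\rm sc}-1}G_k^2-\mu_G^2 .$$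
   Context: Let $N_{\rm sc}\ge 1$ be an integer and ${\rm j}=\sqrt{-1}$. The DFT-precoded subcarrier coefficients are $X_k=\frac{1}{\sqrt{N_{\rm sc}}}\sum_{m=0}^{N_{\rm sc}-1}x[m]e^{-{\rm j}\frac{2\pi}{N_{\rm sc}}km}$, $0\le k\le N_{\rm sc}-1$. After OFDM demodulation over a channel that is constant during the symbol, $Y_k=\widetilde H_kX_k+Z_k$, where $\widetilde H_k\in\mathbb{C}$ are fixed (deterministic) effective channel coefficients (including transmit power and any spectral-shaping window), and $Z_0,\dots,Z_{N_{\rm sc}-1}$ are i.i.d. circularly symmetric complex Gaussian with zero mean and unit variance $\mathbb{E}[|Z_k|^2]=1$, independent of the symbols $x[m]$. A single-tap equalizer with coefficients $E_k\in\mathbb{C}$ (deterministic) is applied, $\widetilde Y_k=E_kY_k$, such that the equalized channel gain $G_k=E_k\widetilde H_k$ is real for every $k$. After DFT de-spreading, the received symbols are $$r[m]=\frac{1}{\sqrt{N_{\rm sc}}}\sum_{k=0}^{N_{\rm sc}-1}\widetilde Y_ke^{{\rm j}\frac{2\pi}{N_{\rm sc}}km}=\mu_Gx[m]+\mathsf{ICI}[m]+n[m],$$ with $g_m=\frac{1}{N_{\rm sc}}\sum_{k=0}^{N_{\rm sc}-1}G_ke^{{\rm j}\frac{2\pi}{N_{\rm sc}}km}$ for $m\in\mathbb{Z}$, $\mu_G=g_0=\frac{1}{N_{\rm sc}}\sum_{k=0}^{N_{\rm sc}-1}G_k$, $\mathsf{ICI}[m]=\sum_{n=0,\,n\neq m}^{N_{\rm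 sc}-1}g_{m-n}x[n]$, and $n[m]=\frac{1}{\sqrt{N_{\rm sc}}}\sum_{k=0}^{N_{\rm sc}-1}E_kZ_ke^{{\rm j}\frac{2\pi}{N_{\rm sc}}km}$. Expectations are over data symbols and noise. *)

theory Defs
  imports "HOL-Probability.Probability"
begin

definition dft :: "nat \<Rightarrow> (nat \<Rightarrow> complex) \<Rightarrow> nat \<Rightarrow> complex" where
  "dft N x k = (1 / complex_of_real (sqrt (real N))) *
     (\<Sum>m<N. x m * cis (- (2 * pi / real N * real k * real m)))"

definition idft :: "nat \<Rightarrow> (nat \<Rightarrow> complex) \<Rightarrow> nat \<Rightarrow> complex" where
  "idft N X m = (1 / complex_of_real (sqrt (real N))) *
     (\<Sum>k<N. X k * cis (2 * pi / real N * real k * real m))"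

definition sc_mean :: "nat \<Rightarrow> (nat \<Rightarrow> real) \<Rightarrow> real" where
  "sc_mean N f = (1 / real N) * (\<Sum>k<N. f k)"

text \<open>One realisation of the link: precoding by the DFT, channel \<open>H\<close> with additive noise \<open>z\<close>,
  single-tap equalizer \<open>E\<close>, and de-spreading.\<close>

definition received ::
  "nat \<Rightarrow> (nat \<Rightarrow> complex) \<Rightarrow> (nat \<Rightarrow> complex) \<Rightarrow> (nat \<Rightarrow> complex) \<Rightarrow> (nat \<Rightarrow> complex)
    \<Rightarrow> nat \<Rightarrow> complex" where
  "received N H E x z = idft N (\<lambda>k. E k * (H k * dft N x k + z k))"

text \<open>The taps \<open>g\<^sub>m\<close>, for all integers \<open>m\<close>. The tap at \<open>0\<close> is the real number
  \<open>sc_mean N G\<close>; see \<open>gain_tap_0\<close> below.\<close>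

definition gain_tap :: "nat \<Rightarrow> (nat \<Rightarrow> real) \<Rightarrow> int \<Rightarrow> complex" where
  "gain_tap N G m = (1 / of_nat N) *
     (\<Sum>k<N. complex_of_real (G k) * cis (2 * pi / real N * real k * real_of_int m))"

lemma gain_tap_0: "gain_tap N G 0 = complex_of_real (sc_mean N G)"
  by (simp add: gain_tap_def sc_mean_def)

definition ici :: "nat \<Rightarrow> (nat \<Rightarrow> real) \<Rightarrow> (nat \<Rightarrow> complex) \<Rightarrow> nat \<Rightarrow> complex" where
  "ici N G x m = (\<Sum>n\<in>{..<N} - {m}. gain_tap N G (int m - int n) * x n)"

definition eq_noise :: "nat \<Rightarrow> (nat \<Rightarrow> complex) \<Rightarrow> (nat \<Rightarrow> complex) \<Rightarrow> nat \<Rightarrow> complex" where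
  "eq_noise N E z = idft N (\<lambda>k. E k * z k)"

definition gain_variance :: "nat \<Rightarrow> (nat \<Rightarrow> real) \<Rightarrow> real" where
  "gain_variance N G = sc_mean N (\<lambda>k. (G k)\<^sup>2) - (sc_mean N G)\<^sup>2"

definition mean_power :: "'w measure \<Rightarrow> ('w \<Rightarrow> complex) \<Rightarrow> real" where
  "mean_power M U = (\<integral>\<omega>. (cmod (U \<omega>))\<^sup>2 \<partial>M)"

definition sinr ::
  "'w measure \<Rightarrow> nat \<Rightarrow> (nat \<Rightarrow> real) \<Rightarrow> (nat \<Rightarrow> complex) \<Rightarrow> (nat \<Rightarrow> 'w \<Rightarrow> complex)
    \<Rightarrow> (nat \<Rightarrow> 'w \<Rightarrow> complex) \<Rightarrow> nat \<Rightarrow> real" where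
  "sinr M N G E x Z m =
     (sc_mean N G)\<^sup>2 /
     (mean_power M (\<lambda>\<omega>. ici N G (\<lambda>n. x n \<omega>) m) +
      mean_power M (\<lambda>\<omega>. eq_noise N E (\<lambda>k. Z k \<omega>) m))"

definition (in prob_space) iid :: "(nat \<Rightarrow> 'a \<Rightarrow> complex) \<Rightarrow> nat set \<Rightarrow> bool" where
  "iid X I \<longleftrightarrow> indep_vars (\<lambda>_. borel) X I \<and>
     (\<forall>i\<in>I. \<forall>j\<in>I. distr M borel (X i) = distr M borel (X j))"

text \<open>Independence of two families as wholes: the two random vectors they form are independent.\<close>

definition (in prob_space) indep_families ::
  "(nat \<Rightarrow> 'a \<Rightarrow> complex) \<Rightarrow> (nat \<Rightarrow> 'a \<Rightarrow> complex) \<Rightarrow> nat set \<Rightarrow> bool" where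
  "indep_families X Y I \<longleftrightarrow>
     indep_var (PiM I (\<lambda>_. borel)) (\<lambda>\<omega>. \<lambda>i\<in>I. X i \<omega>)
               (PiM I (\<lambda>_. borel)) (\<lambda>\<omega>. \<lambda>i\<in>I. Y i \<omega>)"

text \<open>The zero-mean circularly symmetric complex Gaussian law of variance \<open>v\<close> (for \<open>v > 0\<close>):
  real and imaginary parts are independent real Gaussians, each of variance \<open>v / 2\<close>. The second
  parameter of \<open>normal_density\<close> is the standard deviation.\<close>

definition (in prob_space) circ_gaussian :: "real \<Rightarrow> ('a \<Rightarrow> complex) \<Rightarrow> bool" where
  "circ_gaussian v W \<longleftrightarrow>
     distributed M lborel (\<lambda>\<omega>. Re (W \<omega>)) (\<lambda>t. ennreal (normal_density 0 (sqrt (v / 2)) t)) \<and>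
     distributed M lborel (\<lambda>\<omega>. Im (W \<omega>)) (\<lambda>t. ennreal (normal_density 0 (sqrt (v / 2)) t)) \<and>
     indep_var borel (\<lambda>\<omega>. Re (W \<omega>)) borel (\<lambda>\<omega>. Im (W \<omega>))"

end

theory Submission
  imports Defs
begin

text \<open>The interference is a linear combination of centred, pairwise uncorrelated symbols of equal
  power, with the taps \<open>g\<^bsub>m-n\<^esub>\<close>, \<open>n \<noteq> m\<close>, as coefficients, and the noise is a linear combination
  of the \<open>Z\<^sub>k\<close>. All cross terms vanish in expectation, so each power is the sum of the squared
  moduli of the coefficients. For the interference, Parseval's identity gives
  \<open>(\<Sum>n<N. \<bar>g\<^bsub>m-n\<^esub>\<bar>\<^sup>2) = (1/N) * (\<Sum>k<N. G\<^sub>k\<^sup>2)\<close>, from which the missing term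
  \<open>\<bar>g\<^sub>0\<bar>\<^sup>2 = \<mu>\<^sub>G\<^sup>2\<close> is subtracted.\<close>

section \<open>Orthogonality of roots of unity and Parseval for the taps\<close>

text \<open>For \<open>k \<noteq> l\<close> this is a full geometric sum in an \<open>N\<close>-th
  root of unity, and the range of \<open>k\<close> and \<open>l\<close> keeps that root different
  from 1.\<close>

lemma sum_cis_orthogonal:
  fixes k l N :: nat
  assumes "k < N" "l < N"
  shows "(\<Sum>n<N. cis (2 * pi / real N * (real k - real l) * real n)) = (if k = l then of_nat N else 0)"
proof (cases "k = l")
  case False
  let ?\<omega> = "cis (2 * pi / real N * (real k - real l))"
  have N: "real N > 0" using assms by simp
  have "?\<omega> \<noteq> 1"
  proof
    assume "?\<omega> = 1"
    \<comment> \<open>In exponential form, equality with 1 makes the angle an integer multiple of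
      \<open>2 * pi\<close>, so \<open>N\<close> divides \<open>k - l\<close>, which is impossible
      for \<open>0 < \<bar>k - l\<bar> < N\<close>.\<close>
    then have "exp (\<i> * complex_of_real (2 * pi / real N * (real k - real l))) = 1"
      by (simp only: cis_conv_exp)
    then obtain j :: int where "2 * pi / real N * (real k - real l) = of_int (2 * j) * pi"
      by (auto simp: exp_eq_1)
    then have "(2 * pi) * (real k - real l) = (2 * pi) * (of_int j * real N)"
      using N by (simp add: field_simps)
    then have "real k - real l = of_int j * real N" by simp
    then have "real_of_int (int k - int l) = real_of_int (j * int N)" by simp
    then have j: "int k - int l = j * int N" by (simp only: of_int_eq_iff)
    then have "int N dvd int k - int l" by simp
    moreover have "\<bar>int k - int l\<bar> < int N" "int k - int l \<noteq> 0"
      using assms False by auto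
    ultimately show False
      using dvd_imp_le_int[of "int k - int l" "int N"] by linarith
  qed
  moreover have "?\<omega> ^ N = 1"
  proof -
    have "real N * (2 * pi / real N * (real k - real l)) = 2 * pi * (real k - real l)"
      using N by simp
    then have "?\<omega> ^ N = cis (2 * pi * (real k - real l))"
      by (simp only: Complex.DeMoivre)
    then show ?thesis by simp
  qed
  ultimately have "(\<Sum>n<N. ?\<omega> ^ n) = 0" by (simp add: geometric_sum)
  then show ?thesis using False by (simp add: Complex.DeMoivre mult_ac)
qed simp

lemma gain_tap_parseval:
  "(\<Sum>n<N. (cmod (gain_tap N G (a - int n)))\<^sup>2) = sc_mean N (\<lambda>k. (G k)\<^sup>2)"
proof (cases "N = 0")
  case False
  define c where "c k = complex_of_real (G k) * cis (2 * pi / real N * real k * real_of_int a)" for k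
  let ?w = "\<lambda>k l n. cis (2 * pi / real N * (real k - real l) * real n)"
  \<comment> \<open>The phase coming from the shift \<open>a\<close> goes into \<open>c\<close>;
    what is left is a plain Fourier sum in \<open>n\<close>.\<close>
  have tap: "gain_tap N G (a - int n) =
      (1 / of_nat N) * (\<Sum>k<N. c k * cis (- (2 * pi / real N * real k * real n)))" for n
    by (simp add: gain_tap_def c_def mult.assoc cis_mult right_diff_distrib)
  have "complex_of_real (\<Sum>n<N. (cmod (gain_tap N G (a - int n)))\<^sup>2) =
      (\<Sum>n<N. (1 / of_nat N)\<^sup>2 * (\<Sum>k<N. \<Sum>l<N. c k * cnj (c l) * ?w l k n))"
  proof -
    \<comment> \<open>The indices appear as \<open>?w l k\<close> because the kernel in
      \<open>tap\<close> has a negative exponent and conjugation flips the sign of the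
      \<open>l\<close> term.\<close>
    have w: "cis (- (2 * pi / real N * real k * real n)) *
        cnj (cis (- (2 * pi / real N * real l * real n))) = ?w l k n" for k l n
      by (simp add: cis_cnj cis_mult algebra_simps diff_divide_distrib)
    show ?thesis
      unfolding of_real_sum complex_norm_square tap w[symmetric]
      by (simp add: power2_eq_square sum_product mult_ac)
  qed
  also have "\<dots> = (1 / of_nat N)\<^sup>2 * (\<Sum>k<N. \<Sum>l<N. c k * cnj (c l) * (\<Sum>n<N. ?w l k n))"
    unfolding sum_distrib_left by (subst sum.swap, intro sum.cong refl sum.swap)
  also have "\<dots> = (1 / of_nat N)\<^sup>2 * (\<Sum>k<N. c k * cnj (c k) * of_nat N)"
  proof -
    have "(\<Sum>l<N. c k * cnj (c l) * (\<Sum>n<N. ?w l k n)) =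
        (\<Sum>l<N. if l = k then c k * cnj (c k) * of_nat N else 0)" if "k < N" for k
      by (intro sum.cong refl, subst sum_cis_orthogonal) (use that in auto)
    then show ?thesis by simp
  qed
  also have "\<dots> = complex_of_real (sc_mean N (\<lambda>k. (G k)\<^sup>2))"
  proof -
    \<comment> \<open>The phase in \<open>c\<close> has modulus 1, so the dependence on
      \<open>a\<close> disappears here.\<close>
    have "c k * cnj (c k) = of_real ((G k)\<^sup>2)" for k
      unfolding complex_norm_square[symmetric] by (simp add: c_def norm_mult)
    then show ?thesis
      using False by (simp add: sc_mean_def power2_eq_square sum_distrib_right[symmetric])
  qed
  finally show ?thesis by (simp only: of_real_eq_iff)
qed (simp add: sc_mean_def)

lemma gain_tap_punctured_power:
  assumes "m < N"
  shows "(\<Sum>n\<in>{..<N} - {m}. (cmod (gain_tap N G (int m - int n)))\<^sup>2) = gain_variance N G"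
proof -
  have "(\<Sum>n<N. (cmod (gain_tap N G (int m - int n)))\<^sup>2) =
      (sc_mean N G)\<^sup>2 + (\<Sum>n\<in>{..<N} - {m}. (cmod (gain_tap N G (int m - int n)))\<^sup>2)"
    using assms by (subst sum.remove[of _ m]) (auto simp: gain_tap_0)
  then show ?thesis by (simp add: gain_tap_parseval gain_variance_def)
qed

section \<open>Decomposition of the received symbol\<close>

text \<open>Multiplication by \<open>G\<close> between a DFT and its inverse is circular convolution
  with the inverse transform of \<open>G\<close>: the two phases merge into one depending on
  \<open>m - n\<close>, and the two factors \<open>1 / sqrt N\<close> into the \<open>1 / N\<close>
  of \<open>gain_tap\<close>.\<close>

lemma received_eq_tap_sum:
  assumes "\<And>k. k < N \<Longrightarrow> E k * H k = complex_of_real (G k)"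
  shows "received N H E x z m =
    (\<Sum>n<N. gain_tap N G (int m - int n) * x n) + eq_noise N E z m"
proof -
  let ?s = "1 / complex_of_real (sqrt (real N))"
  have s: "?s * ?s = 1 / of_nat N"
    by (simp flip: of_real_mult)
  have "idft N (\<lambda>k. E k * (H k * dft N x k)) m =
      ?s * (\<Sum>k<N. of_real (G k) * (?s * (\<Sum>n<N. x n * cis (- (2 * pi / real N * real k * real n))))
        * cis (2 * pi / real N * real k * real m))"
    unfolding idft_def dft_def
    by (rule arg_cong[where f = "(*) _"], rule sum.cong) (simp_all add: assms flip: mult.assoc)
  also have "\<dots> = (?s * ?s) * (\<Sum>k<N. \<Sum>n<N. of_real (G k) * x n *
      cis (2 * pi / real N * real k * (real m - real n)))"
  proof -
    have w: "cis (2 * pi / real N * real k * (real m - real n)) =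
        cis (- (2 * pi / real N * real k * real n)) * cis (2 * pi / real N * real k * real m)" for k n
      by (simp add: cis_mult algebra_simps diff_divide_distrib)
    show ?thesis
      unfolding w sum_distrib_left sum_distrib_right by (intro sum.cong refl) (simp only: mult_ac)
  qed
  also have "\<dots> = (\<Sum>n<N. gain_tap N G (int m - int n) * x n)"
    unfolding s gain_tap_def
    by (subst sum.swap) (simp add: sum_distrib_left sum_distrib_right mult_ac)
  finally show ?thesis
    by (simp add: received_def eq_noise_def idft_def distrib_left distrib_right sum.distrib)
qed

lemma received_decomposition:
  assumes "\<And>k. k < N \<Longrightarrow> E k * H k = complex_of_real (G k)" and "m < N"
  shows "received N H E x z m =
    complex_of_real (sc_mean N G) * x m + ici N G x m + eq_noise N E z m"
proof -
  have "(\<Sum>n<N. gain_tap N G (int m - int n) * x n) = gain_tap N G 0 * x m + ici N G x m"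
    unfolding ici_def using \<open>m < N\<close> by (subst sum.remove[of _ m]) auto
  then show ?thesis
    by (simp add: received_eq_tap_sum[of N E H G, OF assms(1)] gain_tap_0)
qed

section \<open>Second moments of sums of independent variables\<close>

context prob_space
begin

lemma integrable_of_cmod_square:
  fixes X :: "'a \<Rightarrow> complex"
  assumes "random_variable borel X" "integrable M (\<lambda>\<omega>. (cmod (X \<omega>))\<^sup>2)"
  shows "integrable M X"
proof (rule square_integrable_imp_integrable)
  show "integrable M (\<lambda>\<omega>. (X \<omega>)\<^sup>2)"
    \<comment> \<open>The complex square is dominated by the given function, since its modulus
      equals \<open>(cmod (X \<omega>))\<^sup>2\<close>.\<close>
    using assms by (intro Bochner_Integration.integrable_bound[OF assms(2)]) (auto simp: norm_power)
qed fact

lemma indep_vars_cross_moment: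
  fixes X :: "'i \<Rightarrow> 'a \<Rightarrow> complex"
  assumes "indep_vars (\<lambda>_. borel) X I" "i \<in> I" "j \<in> I" "i \<noteq> j"
    and "integrable M (X i)" "integrable M (X j)"
  shows "has_bochner_integral M (\<lambda>\<omega>. X i \<omega> * cnj (X j \<omega>)) (expectation (X i) * cnj (expectation (X j)))"
proof -
  have "cnj \<in> borel_measurable borel"
    by (intro borel_measurable_continuous_onI continuous_intros)
  then have "(\<lambda>f. cnj (f j)) \<in> borel_measurable (PiM {j} (\<lambda>_. borel))"
    by (rule measurable_compose[rotated]) simp
  \<comment> \<open>Pairwise independence comes from restricting the family to the disjoint sets
    \<open>{i}\<close> and \<open>{j}\<close>, then evaluating and, for \<open>j\<close>,
    conjugating.\<close>
  then have "indep_var borel ((\<lambda>f. f i) \<circ> (\<lambda>\<omega>. restrict (\<lambda>i. X i \<omega>) {i}))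
      borel ((\<lambda>f. cnj (f j)) \<circ> (\<lambda>\<omega>. restrict (\<lambda>i. X i \<omega>) {j}))"
    using assms(2-4)
    by (intro indep_var_compose[OF indep_var_restrict[OF assms(1)]]
        measurable_component_singleton) auto
  then have "indep_var borel (X i) borel (\<lambda>\<omega>. cnj (X j \<omega>))" by (simp add: comp_def)
  from indep_var_integrable[OF this] indep_var_lebesgue_integral[OF this]
  show ?thesis using assms(5,6) by (simp add: has_bochner_integral_iff)
qed

text \<open>Serves both the interference and the noise. Using \<open>has_bochner_integral\<close>
  carries integrability along with the value.\<close>

lemma indep_sum_power:
  fixes X :: "'i \<Rightarrow> 'a \<Rightarrow> complex"
  assumes "finite I" and indep: "indep_vars (\<lambda>_. borel) X I"
    and mean: "\<And>i. i \<in> I \<Longrightarrow> expectation (X i) = 0"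
    and power: "\<And>i. i \<in> I \<Longrightarrow> has_bochner_integral M (\<lambda>\<omega>. (cmod (X i \<omega>))\<^sup>2) v"
  shows "has_bochner_integral M (\<lambda>\<omega>. (cmod (\<Sum>i\<in>I. c i * X i \<omega>))\<^sup>2) (v * (\<Sum>i\<in>I. (cmod (c i))\<^sup>2))"
proof -
  have int: "integrable M (X i)" if "i \<in> I" for i
    using power[OF that] indep that
    by (intro integrable_of_cmod_square) (auto simp: has_bochner_integral_iff indep_vars_def)
  have cross: "has_bochner_integral M (\<lambda>\<omega>. X i \<omega> * cnj (X j \<omega>)) (if i = j then of_real v else 0)"
    if "i \<in> I" "j \<in> I" for i j
  proof (cases "i = j")
    case True
    have "has_bochner_integral M (\<lambda>\<omega>. complex_of_real ((cmod (X i \<omega>))\<^sup>2)) (of_real v)"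
      using power[OF \<open>i \<in> I\<close>] by (rule has_bochner_integral_of_real)
    then show ?thesis
      using True unfolding complex_norm_square by simp
  next
    case False
    then show ?thesis
      using indep_vars_cross_moment[OF indep that False int int] that by (simp add: mean)
  qed
  \<comment> \<open>The expansion lives in the complex numbers, where the squared modulus is a
    product with the conjugate; taking real parts at the end returns to the reals.\<close>
  have expand: "complex_of_real ((cmod (\<Sum>i\<in>I. c i * X i \<omega>))\<^sup>2) =
      (\<Sum>i\<in>I. \<Sum>j\<in>I. c i * cnj (c j) * (X i \<omega> * cnj (X j \<omega>)))" for \<omega>
    unfolding complex_norm_square by (simp add: sum_product mult_ac)
  have "has_bochner_integral M (\<lambda>\<omega>. \<Sum>i\<in>I. \<Sum>j\<in>I. c i * cnj (c j) * (X i \<omega> * cnj (X j \<omega>)))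
      (\<Sum>i\<in>I. \<Sum>j\<in>I. c i * cnj (c j) * (if i = j then of_real v else 0))"
    by (intro has_bochner_integral_sum has_bochner_integral_mult_right cross)
  also have "(\<Sum>i\<in>I. \<Sum>j\<in>I. c i * cnj (c j) * (if i = j then of_real v else 0)) =
      complex_of_real (v * (\<Sum>i\<in>I. (cmod (c i))\<^sup>2))"
    using \<open>finite I\<close>
    by (simp add: if_distrib[of "(*) _"] sum_distrib_left complex_norm_square
        mult_ac cong: if_cong del: of_real_power)
  finally have "has_bochner_integral M (\<lambda>\<omega>. complex_of_real ((cmod (\<Sum>i\<in>I. c i * X i \<omega>))\<^sup>2))
      (complex_of_real (v * (\<Sum>i\<in>I. (cmod (c i))\<^sup>2)))"
    unfolding expand .
  from has_bochner_integral_Re[OF this] show ?thesis by simp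
qed

lemma circ_gaussian_mean:
  assumes "circ_gaussian v W" "v > 0" "integrable M W"
  shows "expectation W = 0"
proof -
  have "expectation (\<lambda>\<omega>. Re (W \<omega>)) = 0" "expectation (\<lambda>\<omega>. Im (W \<omega>)) = 0"
    using assms(1,2) by (auto simp: circ_gaussian_def simp del: integral_Re integral_Im
        intro!: normal_distributed_expectation[of "sqrt (v / 2)" _ 0])
  then show ?thesis using assms(3) by (simp add: complex_eq_iff)
qed

lemma normal_distributed_second_moment:
  assumes "\<sigma> > 0" and D: "distributed M lborel Y (normal_density 0 \<sigma>)"
  shows "has_bochner_integral M (\<lambda>\<omega>. (Y \<omega>)\<^sup>2) (\<sigma>\<^sup>2)"
proof -
  \<comment> \<open>The variance formula only gives the value of an integral, so integrability is
    obtained separately from the Gaussian moments.\<close>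
  have "integrable M (\<lambda>\<omega>. (Y \<omega>)\<^sup>2)"
    using distributed_integrable[OF D, of "\<lambda>y. y\<^sup>2"] integrable_normal_moment[OF \<open>\<sigma> > 0\<close>, of 0 2]
    by simp
  then show ?thesis
    using normal_distributed_variance[OF assms] normal_distributed_expectation[OF assms]
    by (simp add: has_bochner_integral_iff)
qed

text \<open>The squared modulus splits into squared real and imaginary parts, each contributing
  \<open>v / 2\<close>.\<close>

lemma circ_gaussian_power:
  assumes "circ_gaussian v W" "v > 0"
  shows "has_bochner_integral M (\<lambda>\<omega>. (cmod (W \<omega>))\<^sup>2) v"
proof -
  have "has_bochner_integral M (\<lambda>\<omega>. (Re (W \<omega>))\<^sup>2 + (Im (W \<omega>))\<^sup>2)
      ((sqrt (v / 2))\<^sup>2 + (sqrt (v / 2))\<^sup>2)"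
    using assms by (intro has_bochner_integral_add normal_distributed_second_moment)
      (auto simp: circ_gaussian_def)
  then show ?thesis using \<open>v > 0\<close> by (simp add: cmod_power2)
qed

section \<open>Interference and noise powers\<close>

lemma ici_power:
  assumes "m < N" and indep: "indep_vars (\<lambda>_. borel) x {..<N}"
    and "\<And>n. n < N \<Longrightarrow> expectation (x n) = 0"
    and power: "\<And>n. n < N \<Longrightarrow> mean_power M (x n) = 1"
  shows "has_bochner_integral M (\<lambda>\<omega>. (cmod (ici N G (\<lambda>n. x n \<omega>) m))\<^sup>2) (gain_variance N G)"
proof -
  \<comment> \<open>A non-integrable function has integral \<open>0\<close>, so energy \<open>1\<close> forces square integrability.\<close>
  have "has_bochner_integral M (\<lambda>\<omega>. (cmod (x n \<omega>))\<^sup>2) 1" if "n < N" for n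
    using power[OF that] not_integrable_integral_eq
    by (fastforce simp: has_bochner_integral_iff mean_power_def)
  then have "has_bochner_integral M
      (\<lambda>\<omega>. (cmod (\<Sum>n\<in>{..<N} - {m}. gain_tap N G (int m - int n) * x n \<omega>))\<^sup>2)
      (1 * (\<Sum>n\<in>{..<N} - {m}. (cmod (gain_tap N G (int m - int n)))\<^sup>2))"
    using assms by (intro indep_sum_power indep_vars_subset[OF indep]) auto
  then show ?thesis
    by (simp add: ici_def gain_tap_punctured_power[OF \<open>m < N\<close>])
qed

lemma eq_noise_power:
  assumes indep: "indep_vars (\<lambda>_. borel) Z {..<N}"
    and gaussian: "\<And>k. k < N \<Longrightarrow> circ_gaussian 1 (Z k)"
  shows "has_bochner_integral M (\<lambda>\<omega>. (cmod (eq_noise N E (\<lambda>k. Z k \<omega>) m))\<^sup>2)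
    (sc_mean N (\<lambda>k. (cmod (E k))\<^sup>2))"
proof -
  \<comment> \<open>De-spreading only adds a unimodular phase, so \<open>cmod (c k)\<close> is
    \<open>cmod (E k) / sqrt N\<close> for every \<open>m\<close>.\<close>
  define c where "c k = 1 / complex_of_real (sqrt (real N)) * E k *
    cis (2 * pi / real N * real k * real m)" for k
  have power: "has_bochner_integral M (\<lambda>\<omega>. (cmod (Z k \<omega>))\<^sup>2) 1" if "k < N" for k
    using circ_gaussian_power[OF gaussian[OF that]] by simp
  have "integrable M (Z k)" if "k < N" for k
    using power[OF that] indep that
    by (intro integrable_of_cmod_square) (auto simp: has_bochner_integral_iff indep_vars_def)
  then have "has_bochner_integral M (\<lambda>\<omega>. (cmod (\<Sum>k<N. c k * Z k \<omega>))\<^sup>2)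
      (1 * (\<Sum>k<N. (cmod (c k))\<^sup>2))"
    using indep power gaussian
    by (intro indep_sum_power) (auto intro!: circ_gaussian_mean)
  moreover have "(\<Sum>k<N. c k * Z k \<omega>) = eq_noise N E (\<lambda>k. Z k \<omega>) m" for \<omega>
    by (simp add: c_def eq_noise_def idft_def sum_distrib_left mult_ac)
  moreover have "(\<Sum>k<N. (cmod (c k))\<^sup>2) = sc_mean N (\<lambda>k. (cmod (E k))\<^sup>2)"
    by (simp add: c_def sc_mean_def sum_distrib_left norm_mult norm_divide power_mult_distrib
        power_divide)
  ultimately show ?thesis by simp
qed

end

theorem proposition1:
  fixes M :: "'w measure" and N :: nat
    and x Z :: "nat \<Rightarrow> 'w \<Rightarrow> complex"
    and H E :: "nat \<Rightarrow> complex" and G :: "nat \<Rightarrow> real"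
  assumes "prob_space M"
    and "N \<ge> 1"
    and gain_real: "\<And>k. k < N \<Longrightarrow> E k * H k = complex_of_real (G k)"
    and symbols_iid: "prob_space.iid M x {..<N}"
    and symbols_mean: "\<And>n. n < N \<Longrightarrow> (\<integral>\<omega>. x n \<omega> \<partial>M) = 0"
    and symbols_energy: "\<And>n. n < N \<Longrightarrow> mean_power M (x n) = 1"
    and noise_iid: "prob_space.iid M Z {..<N}"
    and noise_gaussian: "\<And>k. k < N \<Longrightarrow> prob_space.circ_gaussian M 1 (Z k)"
    and symbols_noise_indep: "prob_space.indep_families M x Z {..<N}"
  shows "\<forall>m<N.
     (\<forall>\<omega>. received N H E (\<lambda>n. x n \<omega>) (\<lambda>k. Z k \<omega>) m =
        complex_of_real (sc_mean N G) * x m \<omega>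
          + ici N G (\<lambda>n. x n \<omega>) m + eq_noise N E (\<lambda>k. Z k \<omega>) m) \<and>
     sinr M N G E x Z m =
       (sc_mean N G)\<^sup>2 / (gain_variance N G + sc_mean N (\<lambda>k. (cmod (E k))\<^sup>2)) \<and>
     integrable M (\<lambda>\<omega>. (cmod (eq_noise N E (\<lambda>k. Z k \<omega>) m))\<^sup>2) \<and>
     mean_power M (\<lambda>\<omega>. eq_noise N E (\<lambda>k. Z k \<omega>) m) = sc_mean N (\<lambda>k. (cmod (E k))\<^sup>2) \<and>
     integrable M (\<lambda>\<omega>. (cmod (ici N G (\<lambda>n. x n \<omega>) m))\<^sup>2) \<and>
     mean_power M (\<lambda>\<omega>. ici N G (\<lambda>n. x n \<omega>) m) = gain_variance N G"
proof -
  interpret prob_space M by fact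
  have x: "indep_vars (\<lambda>_. borel) x {..<N}" and Z: "indep_vars (\<lambda>_. borel) Z {..<N}"
    using symbols_iid noise_iid by (auto simp: iid_def)
  show ?thesis
    using received_decomposition[OF gain_real] ici_power[OF _ x symbols_mean symbols_energy]
      eq_noise_power[OF Z noise_gaussian]
    by (simp add: sinr_def mean_power_def has_bochner_integral_iff)
qed

end
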